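(* We have $$\sum_{n\geq1}c_n(3\text{-}21)t^n=\frac{t}{1-2t}-\sum_{i\geq1}\frac{(-1)^i\,t^{2i}(1-t)^{\binom{i}{2}}(1-2t)\sum_{j=1}^i\frac{t^{j}}{(1-3t+t^2)(1-t)^{j-1}-(1-2t)t^{j}}}{\prod_{j=1}^i\left((1-3t+t^2)(1-t)^{j-1}-(1-2t)t^{j}\right)}.$$
   Context: A Catalan word of length $n\ge 1$ is a sequence $\pi=\pi_1\cdots\pi_n$ of positive integers with $\pi_1=1$ and $\pi_{i+1}\le \pi_i+1$ for $1\le i\le n-1$; $\mathcal{C}_n$ is the set of these. Two sequences of the same length are order-isomorphic if their corresponding pairs of entries stand in the same relation ($<$, $>$ or $=$). A word $\pi$ contains the vincular pattern $x\text{-}yz$ if there are indices $i<j$ with $j+1\le n$ such that $\pi_i\pi_j\pi_{j+1}$ is order-isomorphic to $xyz$ (the last two letters must be adjacent in $\pi$); otherwise $\pi$ avoids it. $c_n(\tau)$ denotes the number of members of $\mathcal{C}_n$ avoiding $\tau$. The identity is one of power series in $t$ (rational expressions expanded about $t=0$). *)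

theory Defs
  imports "HOL-Computational_Algebra.Computational_Algebra"
begin

text \<open>
  Words are lists of natural numbers; list positions are counted from 0, so the letter written
  \<open>\<pi>\<^sub>i\<close> in the usual notation is \<open>w ! (i - 1)\<close>.
\<close>

definition catalan_word :: "nat list \<Rightarrow> bool" where
  "catalan_word w \<longleftrightarrow>
     length w \<ge> 1 \<and> (\<forall>a\<in>set w. a \<ge> 1) \<and> w ! 0 = 1 \<and>
     (\<forall>i. i + 1 < length w \<longrightarrow> w ! (i + 1) \<le> w ! i + 1)"

definition catalan_words :: "nat \<Rightarrow> nat list set" where
  "catalan_words n = {w. catalan_word w \<and> length w = n}"

definition order_isomorphic :: "nat list \<Rightarrow> nat list \<Rightarrow> bool" where
  "order_isomorphic u v \<longleftrightarrow>
     length u = length v \<and>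
     (\<forall>i < length u. \<forall>j < length u.
        (u ! i < u ! j \<longleftrightarrow> v ! i < v ! j) \<and>
        (u ! i > u ! j \<longleftrightarrow> v ! i > v ! j) \<and>
        (u ! i = u ! j \<longleftrightarrow> v ! i = v ! j))"

text \<open>
  The triple \<open>(x, y, z)\<close> stands for the vincular pattern \<open>x-yz\<close>, whose last two letters
  must occupy adjacent positions.
\<close>

definition contains_vincular :: "nat list \<Rightarrow> nat \<times> nat \<times> nat \<Rightarrow> bool" where
  "contains_vincular w = (\<lambda>(x, y, z).
     \<exists>i j. i < j \<and> j + 1 < length w \<and>
           order_isomorphic [w ! i, w ! j, w ! (j + 1)] [x, y, z])"

definition catalan_avoid_count :: "nat \<times> nat \<times> nat \<Rightarrow> nat \<Rightarrow> nat" where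
  "catalan_avoid_count p n = card {w \<in> catalan_words n. \<not> contains_vincular w p}"

end

theory Submission
  imports Defs
begin

text \<open>
  Whether a letter may be appended to a word avoiding 3-21 depends only on the last letter \<open>a\<close> and the
  maximum \<open>m\<close>: if \<open>a = m\<close>, every letter up to \<open>m + 1\<close> is possible, but after a last letter
  \<open>a < m\<close> no descent is, since the maximum would play the 3 (\<open>contains_321_snoc_iff\<close>). The generating
  functions \<open>gf a m\<close> therefore satisfy linear equations. For \<open>a < m\<close> they form a geometric sum,
  \<open>gf a m = top_gf m * s * (1 - r ^ a)\<close> with \<open>r = t / (1 - t)\<close> and \<open>s = t / (1 - 2 * t)\<close>, and
  the functions \<open>top_gf m = gf m m\<close> are linked by a first-order recurrence involving \<open>r ^ m\<close>
  (\<open>top_gf_rec\<close>).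

  Let \<open>M(u)\<close> be the sum of \<open>top_gf m * u ^ m\<close> over \<open>m \<ge> 1\<close>. The recurrence becomes
  \<open>(1 - 3 * t + t ^ 2 - t * (1 - 2 * t) * u) * M(u) = t * (1 - 2 * t) * u - t * (1 - t) * M(r * u)\<close>,
  and differentiating in \<open>u\<close> gives a similar equation for \<open>u * M'(u) - M(u)\<close>. Summing \<open>gf a m\<close> over all
  \<open>a \<le> m\<close> and using the equation at \<open>u = 1\<close> shows that all avoiders together have the generating
  function \<open>s + s * (M'(1) - M(1))\<close> (\<open>avoider_gf_eq\<close>).

  It remains to expand \<open>M'(1) - M(1)\<close> by iterating the equations along \<open>u = 1, r, r ^ 2, \<dots>\<close>. Each step
  multiplies by \<open>- t * (1 - t)\<close> and divides by one more of the denominators in the theorem (up to powers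
  of \<open>1 - t\<close>); the inner sum of reciprocals comes from differentiating the product of these
  denominators. After \<open>n\<close> steps the remainder is divisible by \<open>t ^ n\<close> (\<open>remainder_step\<close>,
  \<open>summand_sums\<close>), so the expansion converges to \<open>M'(1) - M(1)\<close>.
\<close>

section \<open>Growing an avoider letter by letter\<close>

text \<open>
  The maximum and the last letter are both read as 0 on the empty word. With this convention the
  empty word behaves like any other word ending in its maximum: it can be extended by the letter 1
  only, which is exactly the condition on the first letter of a Catalan word.
\<close>

definition last0 :: "nat list \<Rightarrow> nat" where "last0 w = last (0 # w)"
definition max0 :: "nat list \<Rightarrow> nat" where "max0 w = Max (set (0 # w))"

lemma last0_simps [simp]: "last0 [] = 0" "last0 (w @ [b]) = b"
  by (simp_all add: last0_def)

lemma max0_simps [simp]: "max0 [] = 0" "max0 (w @ [b]) = max (max0 w) b"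
  by (simp_all add: max0_def insert_commute[of 0] max.commute)

lemma le_max0: "x \<in> set w \<Longrightarrow> x \<le> max0 w"
  by (simp add: max0_def)

lemma max0_attained: "x < max0 w \<Longrightarrow> \<exists>y\<in>set w. x < y"
  unfolding max0_def using Max_in[of "set (0 # w)"] by (metis List.finite_set
  bot_nat_0.extremum_strict list.set_intros(1) set_ConsD empty_iff)

lemma last0_le_max0: "last0 w \<le> max0 w"
  by (cases w rule: rev_cases) auto

lemma order_isomorphic_321_iff:
  "order_isomorphic [a, b, c] [3, 2, 1] \<longleftrightarrow> c < b \<and> b < a"
  by (auto simp: order_isomorphic_def less_Suc_eq numeral_3_eq_3 nth_Cons split: nat.splits)

lemma contains_321_iff:
  "contains_vincular w (3, 2, 1) \<longleftrightarrow>
     (\<exists>i j. i < j \<and> j + 1 < length w \<and> w ! (j+1) < w ! j \<and> w ! j < w ! i)"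
  unfolding contains_vincular_def prod.case order_isomorphic_321_iff ..

text \<open>
  A new occurrence of the pattern must use the appended letter as its 1, hence the old last letter as
  its 2; a letter for the 3 exists precisely when the old last letter is not the maximum. So the pair
  (last letter, maximum) decides how a word may be continued.
\<close>

lemma contains_321_snoc_iff:
  "contains_vincular (w @ [b]) (3, 2, 1) \<longleftrightarrow>
     contains_vincular w (3, 2, 1) \<or> (b < last0 w \<and> last0 w < max0 w)"
proof
  assume "contains_vincular (w @ [b]) (3, 2, 1)"
  then obtain i j where ij: "i < j" "j + 1 < length (w @ [b])"
    "(w @ [b]) ! (j+1) < (w @ [b]) ! j" "(w @ [b]) ! j < (w @ [b]) ! i"
    unfolding contains_321_iff by blast
  show "contains_vincular w (3, 2, 1) \<or> (b < last0 w \<and> last0 w < max0 w)"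
  proof (cases "j + 1 < length w")
    case True
    then show ?thesis using ij unfolding contains_321_iff by (auto simp: nth_append)
  next
    case False
    then have j: "j + 1 = length w" using ij by simp
    then have "w ! j = last0 w"
      by (cases w rule: rev_cases) auto
    moreover have "w ! i \<le> max0 w" using ij j by (intro le_max0) auto
    ultimately show ?thesis using ij j by (auto simp: nth_append)
  qed
next
  assume "contains_vincular w (3, 2, 1) \<or> (b < last0 w \<and> last0 w < max0 w)"
  then show "contains_vincular (w @ [b]) (3, 2, 1)"
  proof
    assume "contains_vincular w (3, 2, 1)"
    then obtain i j where ij: "i < j" "j + 1 < length w"
      "w ! (j+1) < w ! j" "w ! j < w ! i"
      unfolding contains_321_iff by blast
    then show ?thesis unfolding contains_321_iff
      by (intro exI[of _ i] exI[of _ j]) (auto simp: nth_append)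
  next
    assume *: "b < last0 w \<and> last0 w < max0 w"
    then obtain v c where w: "w = v @ [c]"
      by (cases w rule: rev_cases) auto
    with * obtain y where "y \<in> set w" "c < y" using max0_attained[of c w] by auto
    then obtain i where i: "i < length v" "c < v ! i" using w by (auto simp: in_set_conv_nth)
    show ?thesis unfolding contains_321_iff
      using i * w by (intro exI[of _ i] exI[of _ "length v"]) (auto simp: nth_append)
  qed
qed

lemma catalan_word_snoc_iff:
  "catalan_word (w @ [b]) \<longleftrightarrow> (w = [] \<or> catalan_word w) \<and> 1 \<le> b \<and> b \<le> last0 w + 1"
proof (cases w rule: rev_cases)
  case Nil
  then show ?thesis by (auto simp: catalan_word_def)
next
  case (snoc v c)
  then show ?thesis
    by (auto simp: catalan_word_def nth_append less_Suc_eq all_conj_distrib Suc_le_eq)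
qed

text \<open>
  The empty word is admitted as the root of the generation tree; it is no Catalan word, so the final
  count leaves it out.
\<close>

definition avoider :: "nat list \<Rightarrow> bool" where
  "avoider w \<longleftrightarrow> w = [] \<or> (catalan_word w \<and> \<not> contains_vincular w (3, 2, 1))"

lemma avoider_Nil [simp]: "avoider []"
  by (simp add: avoider_def)

lemma avoider_snoc_iff:
  "avoider (w @ [b]) \<longleftrightarrow>
     avoider w \<and> 1 \<le> b \<and> b \<le> last0 w + 1 \<and> (last0 w \<le> b \<or> last0 w = max0 w)"
proof -
  have "\<not> contains_vincular [] (3, 2, 1)" unfolding contains_321_iff by simp
  then show ?thesis
    using last0_le_max0[of w]
    unfolding avoider_def catalan_word_snoc_iff contains_321_snoc_iff by auto
qed

section \<open>Counting by last letter and maximum\<close>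

definition avoiders_at :: "nat \<Rightarrow> nat \<Rightarrow> nat \<Rightarrow> nat list set" where
  "avoiders_at n a m = {w. avoider w \<and> length w = n \<and> last0 w = a \<and> max0 w = m}"

text \<open>
  A last letter \<open>a\<close> below the maximum \<open>m\<close> was reached by an arbitrary descent from \<open>m\<close> itself, by
  repeating \<open>a\<close>, or by the ascent from \<open>a - 1\<close>; any other descent would complete the pattern.
\<close>

lemma avoiders_at_Suc_below:
  assumes "0 < a" "a < m"
  shows "avoiders_at (Suc n) a m =
    (\<lambda>w. w @ [a]) ` (avoiders_at n m m \<union> avoiders_at n a m \<union> avoiders_at n (a - 1) m)"
    (is "?L = ?R")
proof
  show "?R \<subseteq> ?L" using assms
    by (auto simp: avoiders_at_def avoider_snoc_iff)
  show "?L \<subseteq> ?R"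
  proof
    fix x assume x: "x \<in> ?L"
    then obtain w where w: "x = w @ [a]"
      unfolding avoiders_at_def by (cases x rule: rev_cases) auto
    show "x \<in> ?R" unfolding w
      using x w assms last0_le_max0[of w]
      by (auto simp: avoiders_at_def avoider_snoc_iff max_def split: if_splits)
  qed
qed

text \<open>
  A word ending in its maximum either has just reached a new maximum, or repeats it, or returns to it
  from the letter one below.
\<close>

lemma avoiders_at_Suc_top:
  assumes "0 < m"
  shows "avoiders_at (Suc n) m m =
    (\<lambda>w. w @ [m]) ` (avoiders_at n (m - 1) (m - 1) \<union> avoiders_at n m m \<union> avoiders_at n (m - 1) m)"
    (is "?L = ?R")
proof
  show "?R \<subseteq> ?L" using assms
    by (auto simp: avoiders_at_def avoider_snoc_iff)
  show "?L \<subseteq> ?R"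
  proof
    fix x assume x: "x \<in> ?L"
    then obtain w where w: "x = w @ [m]"
      unfolding avoiders_at_def by (cases x rule: rev_cases) auto
    show "x \<in> ?R" unfolding w
      using x w assms last0_le_max0[of w]
      by (auto simp: avoiders_at_def avoider_snoc_iff max_def split: if_splits)
  qed
qed

lemma avoider_max0_le: "avoider w \<Longrightarrow> max0 w \<le> length w"
proof (induction w rule: rev_induct)
  case (snoc b w)
  then show ?case using last0_le_max0[of w] by (auto simp: avoider_snoc_iff)
qed simp

lemma avoider_set: "avoider w \<Longrightarrow> set w \<subseteq> {1..length w}"
proof (induction w rule: rev_induct)
  case (snoc b w)
  then show ?case using avoider_max0_le[of "w @ [b]"] by (fastforce simp: avoider_snoc_iff)
qed simp

lemma finite_avoiders_at [simp]: "finite (avoiders_at n a m)"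
  by (rule finite_subset[OF _ finite_lists_length_eq[of "{1..n}" n]])
     (use avoider_set in \<open>auto simp: avoiders_at_def\<close>)

lemma avoiders_at_disjoint: "(a, m) \<noteq> (a', m') \<Longrightarrow> avoiders_at n a m \<inter> avoiders_at n a' m' = {}"
  by (auto simp: avoiders_at_def)

definition count_at :: "nat \<Rightarrow> nat \<Rightarrow> nat \<Rightarrow> nat" where
  "count_at n a m = card (avoiders_at n a m)"

lemma count_at_Suc_below:
  assumes "0 < a" "a < m"
  shows "count_at (Suc n) a m = count_at n m m + count_at n a m + count_at n (a - 1) m"
  unfolding count_at_def avoiders_at_Suc_below[OF assms]
  by (subst card_image, simp add: inj_on_def)
     (use assms in \<open>simp add: card_Un_disjoint Int_Un_distrib2 avoiders_at_disjoint\<close>)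

lemma count_at_Suc_top:
  assumes "0 < m"
  shows "count_at (Suc n) m m = count_at n (m - 1) (m - 1) + count_at n m m + count_at n (m - 1) m"
  unfolding count_at_def avoiders_at_Suc_top[OF assms]
  by (subst card_image, simp add: inj_on_def)
     (use assms in \<open>simp add: card_Un_disjoint Int_Un_distrib2 avoiders_at_disjoint\<close>)

lemma count_at_zero: "count_at 0 a m = (if a = 0 \<and> m = 0 then 1 else 0)"
proof -
  have "avoiders_at 0 a m = (if a = 0 \<and> m = 0 then {[]} else {})"
    by (auto simp: avoiders_at_def avoider_Nil)
  then show ?thesis by (simp add: count_at_def)
qed

lemma count_at_last_zero:
  assumes "n \<noteq> 0 \<or> m \<noteq> 0"
  shows "count_at n 0 m = 0"
proof -
  have "avoiders_at n 0 m = {}"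
  proof (intro equals0I)
    fix w assume "w \<in> avoiders_at n 0 m"
    then show False using assms
      by (cases w rule: rev_cases) (auto simp: avoiders_at_def avoider_snoc_iff)
  qed
  then show ?thesis by (simp add: count_at_def)
qed

lemma count_at_eq_0: "n < m \<Longrightarrow> count_at n a m = 0"
  unfolding count_at_def avoiders_at_def using avoider_max0_le
  by (subst card_eq_0_iff) fastforce

text \<open>
  Nonempty words have a positive maximum, written \<open>Suc m\<close> here, and the maximum is at most the length.
\<close>

lemma catalan_avoid_count_eq:
  assumes "n \<ge> 1"
  shows "catalan_avoid_count (3, 2, 1) n = (\<Sum>m<n. \<Sum>a\<le>Suc m. count_at n a (Suc m))"
proof -
  have "{w \<in> catalan_words n. \<not> contains_vincular w (3, 2, 1)}
      = (\<Union>(m, a) \<in> (SIGMA m:{..<n}. {..Suc m}). avoiders_at n a (Suc m))" (is "?L = ?R")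
  proof
    show "?R \<subseteq> ?L" using assms by (auto simp: avoiders_at_def avoider_def catalan_words_def)
    show "?L \<subseteq> ?R"
    proof
      fix w assume "w \<in> ?L"
      then have w: "avoider w" "length w = n" by (auto simp: avoider_def catalan_words_def)
      then have "max0 w > 0" using assms
        by (cases w rule: rev_cases) (auto simp: avoider_snoc_iff)
      then obtain m where m: "max0 w = Suc m" by (cases "max0 w") auto
      moreover have "m < n" using avoider_max0_le[OF w(1)] w m by simp
      moreover have "last0 w \<le> Suc m" using last0_le_max0[of w] m by simp
      ultimately show "w \<in> ?R" using w by (auto simp: avoiders_at_def)
    qed
  qed
  then have "catalan_avoid_count (3, 2, 1) n
      = card (\<Union>(m, a) \<in> (SIGMA m:{..<n}. {..Suc m}). avoiders_at n a (Suc m))"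
    by (simp only: catalan_avoid_count_def)
  also have "\<dots> = (\<Sum>(m, a) \<in> (SIGMA m:{..<n}. {..Suc m}). count_at n a (Suc m))"
    unfolding split_def count_at_def
    by (subst card_UN_disjoint) (auto intro!: avoiders_at_disjoint)
  also have "\<dots> = (\<Sum>m<n. \<Sum>a\<le>Suc m. count_at n a (Suc m))"
    by (rule sum.Sigma[symmetric]) auto
  finally show ?thesis .
qed

section \<open>Locally finite series of formal power series\<close>

text \<open>
  The sum over all maxima is an infinite sum of power series in which the \<open>m\<close>-th term is divisible
  by the \<open>m\<close>-th power of the variable. Each coefficient then receives finitely many contributions, and
  the sum can be written down coefficientwise without passing to limits.
\<close>

definition adically_null :: "(nat \<Rightarrow> 'a::zero fps) \<Rightarrow> bool" where
  "adically_null g \<longleftrightarrow> (\<forall>m n. n < m \<longrightarrow> fps_nth (g m) n = 0)"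

definition fps_series :: "(nat \<Rightarrow> 'a::comm_monoid_add fps) \<Rightarrow> 'a fps" where
  "fps_series g = Abs_fps (\<lambda>n. \<Sum>m\<le>n. fps_nth (g m) n)"

lemma adically_null_mult:
  fixes g :: "nat \<Rightarrow> 'a::semiring_0 fps"
  shows "adically_null g \<Longrightarrow> adically_null (\<lambda>m. c m * g m)"
  by (auto simp: adically_null_def fps_mult_nth intro!: sum.neutral)

lemma adically_null_Suc: "adically_null g \<Longrightarrow> adically_null (\<lambda>m. g (Suc m))"
  by (simp add: adically_null_def)

lemma fps_series_nth:
  assumes "adically_null g" "n \<le> N"
  shows "fps_nth (fps_series g) n = (\<Sum>m\<le>N. fps_nth (g m) n)"
  unfolding fps_series_def fps_nth_Abs_fps
  by (rule sum.mono_neutral_left) (use assms in \<open>auto simp: adically_null_def\<close>)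

lemma fps_series_add: "fps_series (\<lambda>m. g m + h m) = fps_series g + fps_series h"
  by (simp add: fps_eq_iff fps_series_def sum.distrib)

lemma fps_series_mult_left:
  fixes g :: "nat \<Rightarrow> 'a::semiring_0 fps"
  assumes "adically_null g"
  shows "fps_series (\<lambda>m. c * g m) = c * fps_series g"
proof (rule fps_ext)
  fix n
  have "fps_nth (c * fps_series g) n
      = (\<Sum>i=0..n. fps_nth c i * (\<Sum>m\<le>n. fps_nth (g m) (n - i)))"
    unfolding fps_mult_nth by (intro sum.cong refl) (simp add: fps_series_nth[OF assms, of _ n])
  also have "\<dots> = (\<Sum>m\<le>n. \<Sum>i=0..n. fps_nth c i * fps_nth (g m) (n - i))"
    unfolding sum_distrib_left by (rule sum.swap)
  finally show "fps_nth (fps_series (\<lambda>m. c * g m)) n = fps_nth (c * fps_series g) n"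
    by (simp add: fps_series_def fps_mult_nth)
qed

lemma fps_series_Suc:
  assumes "adically_null g"
  shows "fps_series g = g 0 + fps_series (\<lambda>m. g (Suc m))"
proof (rule fps_ext)
  fix n
  show "fps_nth (fps_series g) n = fps_nth (g 0 + fps_series (\<lambda>m. g (Suc m))) n"
    unfolding fps_series_nth[OF assms le_SucI[OF order_refl]]
    by (simp only: sum.atMost_Suc_shift) (simp add: fps_series_def)
qed

section \<open>Generating functions by last letter and maximum\<close>

definition gf :: "nat \<Rightarrow> nat \<Rightarrow> rat fps" where
  "gf a m = Abs_fps (\<lambda>n. of_nat (count_at n a m))"

abbreviation top_gf :: "nat \<Rightarrow> rat fps" where
  "top_gf m \<equiv> gf m m"

abbreviation t :: "rat fps" where "t \<equiv> fps_X"

text \<open>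
  The geometric ratio \<open>r = t / (1 - t)\<close> is the weight of a maximal run of equal letters, and
  \<open>s = t / (1 - 2 * t)\<close> is \<open>r / (1 - r)\<close>. Both are mostly used through \<open>r_eq\<close> and \<open>s_eq\<close>, which are
  polynomial equations.
\<close>

definition r :: "rat fps" where "r = t * inverse (1 - t)"
definition s :: "rat fps" where "s = t * inverse (1 - 2 * t)"

lemma r_eq: "(1 - t) * r = t"
proof -
  have inverse: "(1 - t) * inverse (1 - t) = 1" by (rule inverse_mult_eq_1') simp
  have "(1 - t) * r = t * ((1 - t) * inverse (1 - t))"
    unfolding r_def by (simp only: mult_ac)
  then show ?thesis unfolding inverse by simp
qed

lemma s_inverse: "(1 - 2 * t) * inverse (1 - 2 * t) = 1"
  by (rule inverse_mult_eq_1') simp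

lemma s_eq: "(1 - 2 * t) * s = t"
proof -
  have "(1 - 2 * t) * s = t * ((1 - 2 * t) * inverse (1 - 2 * t))"
    unfolding s_def by (simp only: mult_ac)
  then show ?thesis unfolding s_inverse by simp
qed

lemma nonzero_nth: "fps_nth f 0 \<noteq> 0 \<Longrightarrow> f \<noteq> 0"
  by auto

lemma one_minus_t_nz: "1 - t \<noteq> 0" "1 - 2 * t \<noteq> 0"
  by (rule nonzero_nth; simp)+

text \<open>
  This allows an identity that holds modulo given equations to be proved by exhibiting it as a
  polynomial identity with explicit multiples of those equations added, and then dropping them.
\<close>

lemma add_multiple_of_equation:
  fixes a c lhs rhs :: "'a::ring"
  shows "lhs = rhs \<Longrightarrow> a + c * (lhs - rhs) = a"
  by simp

lemma gf_below:
  assumes "0 < a" "a < m"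
  shows "gf a m = t * (gf m m + gf a m + gf (a - 1) m)"
proof (rule fps_ext)
  fix n show "fps_nth (gf a m) n = fps_nth (t * (gf m m + gf a m + gf (a - 1) m)) n"
    using assms by (cases n) (simp_all add: gf_def count_at_zero count_at_Suc_below)
qed

lemma gf_top: "top_gf (Suc m) = t * (top_gf m + top_gf (Suc m) + gf m (Suc m))"
proof (rule fps_ext)
  fix n show "fps_nth (gf (Suc m) (Suc m)) n = fps_nth (t * (gf m m + gf (Suc m) (Suc m) + gf m (Suc m))) n"
    by (cases n) (simp_all add: gf_def count_at_zero count_at_Suc_top)
qed

lemma gf_last_zero: "gf 0 m = (if m = 0 then 1 else 0)"
proof (rule fps_ext)
  fix n show "fps_nth (gf 0 m) n = fps_nth (if m = 0 then 1 else 0) n"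
    by (cases n) (auto simp: gf_def count_at_zero count_at_last_zero)
qed

text \<open>
  Solving the equation of \<open>gf_below\<close> for \<open>gf a m\<close> gives \<open>gf a m = r * (top_gf m + gf (a - 1) m)\<close>, so that
  \<open>gf a m\<close> is \<open>top_gf m\<close> times the geometric sum of \<open>r ^ i\<close> for \<open>i = 1, \<dots>, a\<close>.
\<close>

lemma gf_below_closed_form: "a < m \<Longrightarrow> gf a m = top_gf m * s * (1 - r ^ a)"
proof (induction a)
  case 0
  then show ?case by (simp add: gf_last_zero)
next
  case (Suc a)
  have 1: "gf (Suc a) m = t * (gf m m + gf (Suc a) m + gf a m)"
    using gf_below[of "Suc a" m] Suc.prems by simp
  have 2: "gf a m = gf m m * s * (1 - r ^ a)" using Suc by simp
  have "(1 - t) * gf (Suc a) m = (1 - t) * (top_gf m * s * (1 - r * r ^ a))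
      + 1 * (gf (Suc a) m - t * (gf m m + gf (Suc a) m + gf a m))
      + t * (gf a m - top_gf m * s * (1 - r ^ a))
      + (top_gf m * s * r ^ a) * ((1 - t) * r - t)
      + (- top_gf m) * ((1 - 2 * t) * s - t)"
    by algebra
  then have "(1 - t) * gf (Suc a) m = (1 - t) * (top_gf m * s * (1 - r * r ^ a))"
    unfolding 1[THEN add_multiple_of_equation] 2[THEN add_multiple_of_equation]
      r_eq[THEN add_multiple_of_equation] s_eq[THEN add_multiple_of_equation] .
  then show ?case using one_minus_t_nz(1) by simp
qed

text \<open>
  Inserting the closed form for the last letter \<open>m\<close> and maximum \<open>Suc m\<close> into \<open>gf_top\<close> leaves a first-order
  recurrence between consecutive maxima.
\<close>

lemma top_gf_rec:
  "(1 - 3 * t + t ^ 2) * top_gf (Suc m) + t * (1 - t) * r ^ Suc m * top_gf (Suc m)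
     = t * (1 - 2 * t) * top_gf m"
proof -
  note below = gf_below_closed_form[of m "Suc m", OF lessI]
  have "(1 - 3 * t + t ^ 2) * top_gf (Suc m) + t * (1 - t) * (r * r ^ m) * top_gf (Suc m)
      = t * (1 - 2 * t) * top_gf m
        + (1 - 2 * t) * (top_gf (Suc m) - t * (top_gf m + top_gf (Suc m) + gf m (Suc m)))
        + (t * (1 - 2 * t)) * (gf m (Suc m) - top_gf (Suc m) * s * (1 - r ^ m))
        + (t * r ^ m * top_gf (Suc m)) * ((1 - t) * r - t)
        + (t * top_gf (Suc m) * (1 - r ^ m)) * ((1 - 2 * t) * s - t)"
    by algebra
  then show ?thesis
    unfolding gf_top[THEN add_multiple_of_equation] below[THEN add_multiple_of_equation]
      r_eq[THEN add_multiple_of_equation] s_eq[THEN add_multiple_of_equation] power_Suc .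
qed

lemma top_gf_0: "top_gf 0 = 1"
  by (simp add: gf_last_zero)

lemma adically_null_top_gf: "adically_null top_gf"
  by (simp add: adically_null_def gf_def count_at_eq_0)

section \<open>Iterating the functional equation\<close>

text \<open>
  With \<open>M(u)\<close> for the sum of \<open>top_gf m * u ^ m\<close> over \<open>m \<ge> 1\<close>, these are the values at \<open>u = r ^ k\<close> of \<open>M(u)\<close>
  and of \<open>u * M'(u) - M(u)\<close>. Treating the two families separately avoids a second variable and
  formal differentiation.
\<close>

definition top_sum :: "nat \<Rightarrow> rat fps" where
  "top_sum k = fps_series (\<lambda>m. r ^ (k * Suc m) * top_gf (Suc m))"

definition weighted_top_sum :: "nat \<Rightarrow> rat fps" where
  "weighted_top_sum k = fps_series (\<lambda>m. of_nat m * r ^ (k * Suc m) * top_gf (Suc m))"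

lemma adically_null_weighted: "adically_null (\<lambda>m. c m * top_gf (Suc m))"
  by (rule adically_null_mult[OF adically_null_Suc[OF adically_null_top_gf]])

text \<open>
  Multiplying \<open>top_gf_rec\<close> by \<open>r ^ (k * Suc m)\<close> and summing over \<open>m\<close> turns the factor \<open>r ^ Suc m\<close> into the
  step from \<open>k\<close> to \<open>Suc k\<close>; the shift of index on the right splits off the term of the empty word. The
  weights \<open>c\<close> cover both families at once.
\<close>

lemma fps_series_top_gf_rec:
  "(1 - 3 * t + t ^ 2) * fps_series (\<lambda>m. c m * r ^ (k * Suc m) * top_gf (Suc m))
     + t * (1 - t) * fps_series (\<lambda>m. c m * r ^ (Suc k * Suc m) * top_gf (Suc m))
   = t * (1 - 2 * t) * r ^ k * (c 0 + fps_series (\<lambda>m. c (Suc m) * r ^ (k * Suc m) * top_gf (Suc m)))"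
proof -
  have termwise: "(1 - 3 * t + t ^ 2) * (c m * r ^ (k * Suc m) * top_gf (Suc m))
      + t * (1 - t) * (c m * r ^ (Suc k * Suc m) * top_gf (Suc m))
      = t * (1 - 2 * t) * r ^ k * (c m * r ^ (k * m) * top_gf m)" for m
  proof -
    have *: "r ^ (k * Suc m) = r ^ k * r ^ (k * m)" "r ^ (Suc k * Suc m) = r ^ Suc m * (r ^ k * r ^ (k * m))"
      by (simp_all add: power_add mult_ac)
    have "(1 - 3 * t + t ^ 2) * (c m * (r ^ k * r ^ (k * m)) * top_gf (Suc m))
        + t * (1 - t) * (c m * (r ^ Suc m * (r ^ k * r ^ (k * m))) * top_gf (Suc m))
        = t * (1 - 2 * t) * r ^ k * (c m * r ^ (k * m) * top_gf m)
        + (c m * r ^ k * r ^ (k * m))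
          * ((1 - 3 * t + t ^ 2) * top_gf (Suc m) + t * (1 - t) * r ^ Suc m * top_gf (Suc m)
             - t * (1 - 2 * t) * top_gf m)"
      by algebra
    then show ?thesis unfolding * top_gf_rec[THEN add_multiple_of_equation] .
  qed
  have "adically_null (\<lambda>m. c m * r ^ (k * m) * top_gf m)"
    by (intro adically_null_mult adically_null_top_gf)
  then have "fps_series (\<lambda>m. t * (1 - 2 * t) * r ^ k * (c m * r ^ (k * m) * top_gf m))
     = t * (1 - 2 * t) * r ^ k * (c 0 + fps_series (\<lambda>m. c (Suc m) * r ^ (k * Suc m) * top_gf (Suc m)))"
    by (subst fps_series_mult_left, assumption, subst fps_series_Suc) (simp_all add: top_gf_0)
  then show ?thesis
    unfolding termwise[symmetric] fps_series_add
    by (simp only: fps_series_mult_left[OF adically_null_weighted])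
qed

lemma top_sum_rec:
  "(1 - 3 * t + t ^ 2) * top_sum k + t * (1 - t) * top_sum (Suc k)
     = t * (1 - 2 * t) * r ^ k * (1 + top_sum k)"
  using fps_series_top_gf_rec[of "\<lambda>_. 1" k] by (simp only: top_sum_def mult_1)

lemma weighted_top_sum_rec:
  "(1 - 3 * t + t ^ 2) * weighted_top_sum k + t * (1 - t) * weighted_top_sum (Suc k)
     = t * (1 - 2 * t) * r ^ k * (top_sum k + weighted_top_sum k)"
proof -
  have "fps_series (\<lambda>m. of_nat (Suc m) * r ^ (k * Suc m) * top_gf (Suc m)) = top_sum k + weighted_top_sum k"
    unfolding top_sum_def weighted_top_sum_def fps_series_add[symmetric]
    by (intro arg_cong[of _ _ fps_series] ext) (simp add: algebra_simps)
  then show ?thesis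
    using fps_series_top_gf_rec[of of_nat k] by (simp only: weighted_top_sum_def of_nat_0 add_0_left)
qed

text \<open>
  The equation for \<open>top_sum k\<close> has the coefficient \<open>1 - 3 * t + t ^ 2 - t * (1 - 2 * t) * r ^ k\<close> in front of it.
  Clearing its denominator \<open>(1 - t) ^ k\<close> gives \<open>denom k\<close>, which is the denominator of index \<open>k + 1\<close> in the
  final formula.
\<close>

definition denom :: "nat \<Rightarrow> rat fps" where
  "denom k = (1 - 3 * t + t ^ 2) * (1 - t) ^ k - (1 - 2 * t) * t ^ Suc k"

lemma denom_inverse: "denom k * inverse (denom k) = 1"
  by (rule inverse_mult_eq_1') (simp add: denom_def)

lemma r_power: "(1 - t) ^ k * r ^ k = t ^ k"
  by (simp only: power_mult_distrib[symmetric] r_eq)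

lemma denom_times_top_sum:
  "denom k * top_sum k = (1 - 2 * t) * t ^ Suc k - t * (1 - t) ^ Suc k * top_sum (Suc k)"
proof -
  have "denom k * top_sum k = (1 - 2 * t) * t ^ Suc k - t * (1 - t) ^ Suc k * top_sum (Suc k)
      + (1 - t) ^ k * ((1 - 3 * t + t ^ 2) * top_sum k + t * (1 - t) * top_sum (Suc k)
                        - t * (1 - 2 * t) * r ^ k * (1 + top_sum k))
      + (t * (1 - 2 * t) * (1 + top_sum k)) * ((1 - t) ^ k * r ^ k - t ^ k)"
    unfolding denom_def power_Suc by algebra
  then show ?thesis
    unfolding top_sum_rec[THEN add_multiple_of_equation] r_power[THEN add_multiple_of_equation] .
qed

lemma denom_times_weighted_top_sum:
  "denom k * weighted_top_sum k
     = (1 - 2 * t) * t ^ Suc k * top_sum k - t * (1 - t) ^ Suc k * weighted_top_sum (Suc k)"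
proof -
  have "denom k * weighted_top_sum k = (1 - 2 * t) * t ^ Suc k * top_sum k - t * (1 - t) ^ Suc k * weighted_top_sum (Suc k)
      + (1 - t) ^ k * ((1 - 3 * t + t ^ 2) * weighted_top_sum k + t * (1 - t) * weighted_top_sum (Suc k)
                        - t * (1 - 2 * t) * r ^ k * (top_sum k + weighted_top_sum k))
      + (t * (1 - 2 * t) * (top_sum k + weighted_top_sum k)) * ((1 - t) ^ k * r ^ k - t ^ k)"
    unfolding denom_def power_Suc by algebra
  then show ?thesis
    unfolding weighted_top_sum_rec[THEN add_multiple_of_equation] r_power[THEN add_multiple_of_equation] .
qed

section \<open>The generating function of all avoiders\<close>

lemma one_minus_r: "(1 - r) * (1 + s) = 1"
proof -
  have "((1 - t) * (1 - 2 * t)) * ((1 - r) * (1 + s)) = ((1 - t) * (1 - 2 * t)) * 1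
      + (- (1 - 2 * t) * (1 + s)) * ((1 - t) * r - t) + (1 - 2 * t) * ((1 - 2 * t) * s - t)"
    by algebra
  then have "((1 - t) * (1 - 2 * t)) * ((1 - r) * (1 + s)) = ((1 - t) * (1 - 2 * t)) * 1"
    unfolding r_eq[THEN add_multiple_of_equation] s_eq[THEN add_multiple_of_equation] .
  moreover have "(1 - t) * (1 - 2 * t) \<noteq> 0" using one_minus_t_nz by (metis mult_eq_0_iff)
  ultimately show ?thesis by (metis mult_left_cancel)
qed

lemma sum_one_minus_r_powers:
  "(\<Sum>a\<le>m. 1 - r ^ a) = 1 + of_nat m - (1 + s) * (1 - r ^ Suc m)"
proof (induction m)
  case 0
  then show ?case using one_minus_r by (simp add: mult.commute)
next
  case (Suc m)
  have "(\<Sum>a\<le>Suc m. 1 - r ^ a) = (1 + of_nat m - (1 + s) * (1 - r ^ Suc m)) + (1 - r ^ Suc m)"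
    using Suc by simp
  also have "\<dots> = 1 + (1 + of_nat m) - (1 + s) * (1 - r * r ^ Suc m) + r ^ Suc m * ((1 - r) * (1 + s) - 1)"
    by algebra
  also have "\<dots> = 1 + (1 + of_nat m) - (1 + s) * (1 - r * r ^ Suc m)"
    by (rule one_minus_r[THEN add_multiple_of_equation])
  finally show ?case by simp
qed

text \<open>
  Up to constant factors, the three summands are the \<open>m\<close>-th terms of \<open>top_sum 0\<close>,
  \<open>weighted_top_sum 0\<close> and \<open>top_sum 1\<close>; the exponents \<open>0 * Suc m\<close> and \<open>1 * Suc m\<close> are left
  unsimplified to match these definitions literally.
\<close>

lemma gf_sum_over_last:
  "(\<Sum>a\<le>Suc m. gf a (Suc m)) = (1 - s\<^sup>2) * (r ^ (0 * Suc m) * top_gf (Suc m))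
     + s * (of_nat m * r ^ (0 * Suc m) * top_gf (Suc m)) + s * (1 + s) * (r ^ (1 * Suc m) * top_gf (Suc m))"
proof -
  have "(\<Sum>a\<le>Suc m. gf a (Suc m)) = top_gf (Suc m) + (\<Sum>a\<le>m. top_gf (Suc m) * s * (1 - r ^ a))"
    by (simp add: gf_below_closed_form)
  also have "\<dots> = top_gf (Suc m) + top_gf (Suc m) * s * (\<Sum>a\<le>m. 1 - r ^ a)"
    by (simp only: sum_distrib_left)
  finally show ?thesis
    unfolding sum_one_minus_r_powers by (simp add: algebra_simps power2_eq_square)
qed

definition avoider_gf :: "rat fps" where
  "avoider_gf = Abs_fps (\<lambda>n. if n \<ge> 1 then of_nat (catalan_avoid_count (3, 2, 1) n) else 0)"

lemma avoider_gf_eq_series: "avoider_gf = fps_series (\<lambda>m. \<Sum>a\<le>Suc m. gf a (Suc m))"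
proof (rule fps_ext)
  fix n
  show "fps_nth avoider_gf n = fps_nth (fps_series (\<lambda>m. \<Sum>a\<le>Suc m. gf a (Suc m))) n"
  proof (cases n)
    case 0
    then show ?thesis by (simp add: avoider_gf_def fps_series_def gf_def count_at_zero)
  next
    case (Suc n')
    then have "1 \<le> n" by simp
    then have "fps_nth avoider_gf n = of_nat (\<Sum>m<n. \<Sum>a\<le>Suc m. count_at n a (Suc m))"
      unfolding avoider_gf_def fps_nth_Abs_fps by (simp only: if_True catalan_avoid_count_eq)
    also have "(\<Sum>m<n. \<Sum>a\<le>Suc m. count_at n a (Suc m)) = (\<Sum>m\<le>n. \<Sum>a\<le>Suc m. count_at n a (Suc m))"
      by (simp add: lessThan_Suc_atMost[symmetric] count_at_eq_0)
    finally show ?thesis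
      by (simp only: fps_series_def gf_def fps_nth_Abs_fps fps_sum_nth of_nat_sum)
  qed
qed

text \<open>
  By the functional equation at \<open>k = 0\<close>, the two contributions of \<open>top_sum\<close> collapse to \<open>s\<close>.
\<close>

lemma avoider_gf_eq: "avoider_gf = s + s * weighted_top_sum 0"
proof -
  have split: "avoider_gf = (1 - s\<^sup>2) * top_sum 0 + s * weighted_top_sum 0 + s * (1 + s) * top_sum 1"
    unfolding avoider_gf_eq_series gf_sum_over_last top_sum_def weighted_top_sum_def fps_series_add
    by (simp only: fps_series_mult_left[OF adically_null_weighted])
  have "(1 - 2 * t)\<^sup>2 * ((1 - s\<^sup>2) * top_sum 0 + s * (1 + s) * top_sum 1) = (1 - 2 * t)\<^sup>2 * s"
    using top_sum_rec[of 0] s_eq by (simp only: power_0 One_nat_def[symmetric]) algebra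
  moreover have "(1 - 2 * t)\<^sup>2 \<noteq> 0" using one_minus_t_nz(2) by (rule power_not_zero)
  ultimately have "(1 - s\<^sup>2) * top_sum 0 + s * (1 + s) * top_sum 1 = s"
    by (metis mult_left_cancel)
  then show ?thesis unfolding split by (simp add: algebra_simps)
qed

section \<open>Expansion of the weighted sum\<close>

definition reciprocal_sum :: "nat \<Rightarrow> rat fps" where
  "reciprocal_sum n = (\<Sum>k<n. t ^ Suc k * inverse (denom k))"

text \<open>
  The term of index \<open>Suc n\<close> in the theorem, with its denominators indexed from 0.
\<close>

definition summand :: "nat \<Rightarrow> rat fps" where
  "summand n = (-1) ^ Suc n * t ^ (2 * Suc n) * (1 - t) ^ (Suc n choose 2) * (1 - 2 * t)
     * reciprocal_sum (Suc n) * inverse (\<Prod>k<Suc n. denom k)"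

text \<open>
  What is left of \<open>s * weighted_top_sum 0\<close> after \<open>n\<close> substitutions: the factors \<open>- t * (1 - t) ^ Suc k\<close> and \<open>inverse (denom k)\<close> for \<open>k < n\<close>
  have accumulated; the multiple of \<open>top_sum n\<close> collects the inhomogeneous parts of the equations for
  \<open>weighted_top_sum\<close>.
\<close>

definition remainder :: "nat \<Rightarrow> rat fps" where
  "remainder n = s * (- t) ^ n * (1 - t) ^ (Suc n choose 2) * inverse (\<Prod>k<n. denom k)
     * (weighted_top_sum n + (1 - 2 * t) * top_sum n * reciprocal_sum n)"

text \<open>
  Substituting the functional equations for \<open>weighted_top_sum n\<close> and then for \<open>top_sum n\<close> raises both
  indices by one. The first substitution also produces a multiple of \<open>top_sum n\<close>, which extends the
  sum of reciprocals by its \<open>n\<close>-th term; the inhomogeneous part of the second one is the summand that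
  is split off.
\<close>

lemma remainder_step: "remainder n = remainder (Suc n) - summand n"
proof -
  define C where "C = (1 - t) ^ (Suc n choose 2)"
  define E where "E = inverse (\<Prod>k<n. denom k)"
  define e where "e = (-1 :: rat fps) ^ n"
  define p where "p = t ^ n"
  define G where "G = reciprocal_sum n"
  define I where "I = inverse (denom n)"
  define u where "u = (1 - t) ^ Suc n"
  have C': "(1 - t) ^ (Suc (Suc n) choose 2) = u * C"
    by (simp add: C_def u_def numeral_2_eq_2 flip: power_add)
  have E': "inverse (\<Prod>k<Suc n. denom k) = E * I"
    by (simp add: E_def I_def fps_inverse_mult)
  have G': "reciprocal_sum (Suc n) = G + t * p * I"
    by (simp add: G_def reciprocal_sum_def I_def p_def)
  have neg: "(- t) ^ n = e * p"
    by (simp add: e_def p_def flip: power_mult_distrib)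
  have sq: "t ^ (2 * Suc n) = t * t * p * p"
    by (simp add: p_def mult_2 power_add)
  have DI: "denom n * I = 1" unfolding I_def by (rule denom_inverse)
  have DP: "denom n * top_sum n = (1 - 2 * t) * (t * p) - t * u * top_sum (Suc n)"
    using denom_times_top_sum[of n] by (simp add: p_def u_def)
  have DR: "denom n * weighted_top_sum n = (1 - 2 * t) * (t * p) * top_sum n - t * u * weighted_top_sum (Suc n)"
    using denom_times_weighted_top_sum[of n] by (simp add: p_def u_def)
  have top_sum: "top_sum n = I * ((1 - 2 * t) * (t * p) - t * u * top_sum (Suc n))"
    using DI DP by algebra
  have weighted_top_sum:
    "weighted_top_sum n = I * ((1 - 2 * t) * (t * p) * top_sum n - t * u * weighted_top_sum (Suc n))"
    using DI DR by algebra
  have "weighted_top_sum n + (1 - 2 * t) * top_sum n * G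
      = - (t * u * I * weighted_top_sum (Suc n)) + (1 - 2 * t) * (G + t * p * I) * top_sum n"
    by (subst weighted_top_sum) (simp add: algebra_simps)
  also have "\<dots> = - (t * u * I) * (weighted_top_sum (Suc n) + (1 - 2 * t) * top_sum (Suc n) * (G + t * p * I))
      + (1 - 2 * t) * (G + t * p * I) * I * (1 - 2 * t) * (t * p)"
    by (subst top_sum) (simp add: algebra_simps)
  finally have key: "weighted_top_sum n + (1 - 2 * t) * top_sum n * G = \<dots>" .
  have rem: "remainder n = s * (e * p) * C * E * (weighted_top_sum n + (1 - 2 * t) * top_sum n * G)"
    by (simp only: remainder_def neg C_def E_def G_def)
  have rem': "remainder (Suc n) = s * (- t * (e * p)) * (u * C) * (E * I)
      * (weighted_top_sum (Suc n) + (1 - 2 * t) * top_sum (Suc n) * (G + t * p * I))"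
    by (simp only: remainder_def power_Suc[of "- t"] neg C' E' G')
  have sum: "summand n = - e * (t * t * p * p) * C * (1 - 2 * t) * (G + t * p * I) * (E * I)"
    unfolding summand_def sq E' G' by (simp add: C_def e_def)
  have "remainder n = remainder (Suc n) - summand n
      + (e * p * C * E * (1 - 2 * t) * (G + t * p * I) * I * t * p) * ((1 - 2 * t) * s - t)"
    unfolding rem rem' sum key by algebra
  then show ?thesis unfolding s_eq[THEN add_multiple_of_equation] .
qed

text \<open>
  Telescoping leaves only the remainder, and that is divisible by \<open>t ^ n\<close>, so each of its coefficients is
  eventually 0.
\<close>

lemma summand_sums: "summand sums - (s * weighted_top_sum 0)"
proof -
  have partial: "(\<Sum>i<n. summand i) = remainder n - s * weighted_top_sum 0" for n
  proof (induction n)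
    case 0
    show ?case by (simp add: remainder_def reciprocal_sum_def numeral_2_eq_2)
  next
    case (Suc n)
    then show ?case using remainder_step[of n] by (simp add: algebra_simps)
  qed
  have small: "fps_nth (remainder n) k = 0" if "k < n" for n k
  proof -
    have "remainder n = t ^ n * (s * (-1) ^ n * (1 - t) ^ (Suc n choose 2) * inverse (\<Prod>k<n. denom k)
     * (weighted_top_sum n + (1 - 2 * t) * top_sum n * reciprocal_sum n))"
      unfolding remainder_def power_minus[of t n] by (simp only: mult_ac)
    then show ?thesis using that by (simp only: fps_X_power_mult_nth if_True)
  qed
  show ?thesis unfolding sums_def partial
  proof (rule tendsto_fpsI)
    fix k
    show "\<forall>\<^sub>F n in sequentially. fps_nth (remainder n - s * weighted_top_sum 0) k
      = fps_nth (- (s * weighted_top_sum 0)) k"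
      using eventually_gt_at_top[of k] by eventually_elim (simp add: small)
  qed
qed

theorem theorem2p4:
  shows "let t = (fps_X :: rat fps);
             d = (\<lambda>j::nat. (1 - 3 * t + t ^ 2) * (1 - t) ^ (j - 1) - (1 - 2 * t) * t ^ j);
             f = (\<lambda>i::nat. ((- 1) ^ i * t ^ (2 * i) * (1 - t) ^ (i choose 2) * (1 - 2 * t)
                            * (\<Sum>j = 1..i. t ^ j / d j)) / (\<Prod>j = 1..i. d j))
         in summable (\<lambda>i. f (Suc i)) \<and>
            Abs_fps (\<lambda>n. if n \<ge> 1 then of_nat (catalan_avoid_count (3, 2, 1) n) else 0)
              = t / (1 - 2 * t) - (\<Sum>i. f (Suc i))"
proof -
  define d where "d = (\<lambda>j::nat. (1 - 3 * t + t ^ 2) * (1 - t) ^ (j - 1) - (1 - 2 * t) * t ^ j)"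
  define f where "f = (\<lambda>i::nat. ((- 1) ^ i * t ^ (2 * i) * (1 - t) ^ (i choose 2) * (1 - 2 * t)
                            * (\<Sum>j = 1..i. t ^ j / d j)) / (\<Prod>j = 1..i. d j))"
  have d: "d (Suc k) = denom k" for k
    by (simp add: d_def denom_def)
  have denom0: "fps_nth (denom k) 0 = 1" for k
    by (simp add: denom_def fps_power_zeroth)
  have prod0: "fps_nth (\<Prod>k<n. denom k) 0 = 1" for n
    by (induction n) (simp_all add: denom0)
  have divide_denom: "g / denom k = g * inverse (denom k)" for g k
    by (simp add: fps_divide_unit denom0)
  have divide_prod: "g / (\<Prod>k<n. denom k) = g * inverse (\<Prod>k<n. denom k)" for g n
    by (simp add: fps_divide_unit prod0)
  have "f (Suc i) = summand i" for i
    unfolding f_def summand_def reciprocal_sum_def One_nat_def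
      sum.atLeast1_atMost_eq prod.atLeast1_atMost_eq d divide_denom divide_prod ..
  then have sums: "(\<lambda>i. f (Suc i)) sums - (s * weighted_top_sum 0)"
    using summand_sums by simp
  have "avoider_gf = t / (1 - 2 * t) - (\<Sum>i. f (Suc i))"
    unfolding sums_unique[OF sums, symmetric] avoider_gf_eq by (simp add: s_def fps_divide_unit)
  then show ?thesis
    using sums_summable[OF sums] unfolding avoider_gf_def f_def d_def Let_def by blast
qed

end
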